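(* For every $\varepsilon>0$ there is an $\eta>0$ such that for all sufficiently large $n$ the following holds: if $\mathcal{F}$ is a maximal $3$-wise intersecting family of subsets of $[n]$ with $|\mathcal{F}| \le (1+\eta)2^{(n+2)/2}$, then $n$ is even and there is a balanced pair of linked cubes $\mathcal{L}$ over $[n]$ such that all but at most $\varepsilon|\mathcal{F}|$ members of $\mathcal{F}$ belong to $\mathcal{L}$.
   Context: A family $\mathcal{F}$ of subsets of $[n]=\{1,\ldots,n\}$ is $k$-wise intersecting if every collection of at most $k$ members of $\mathcal{F}$ has a common element; it is maximal $k$-wise intersecting if moreover no subset of $[n]$ outside $\mathcal{F}$ can be added to $\mathcal{F}$ while preserving this property. A pair of linked cubes is a family of the form $\{A : S \subsetneq A \subseteq [n]\} \cup \{B : [n]\setminus S \subsetneq B \subseteq [n]\}$ for some $S \subseteq [n]$; it is balanced if $\lfloor n/2\rfloor \le |S| \le \lceil n/2 \rceil$. *)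

theory Defs
  imports Complex_Main
begin

definition k_wise_intersecting :: "nat \<Rightarrow> nat \<Rightarrow> nat set set \<Rightarrow> bool" where
  "k_wise_intersecting n k F \<longleftrightarrow>
     (\<forall>A\<in>F. A \<subseteq> {1..n}) \<and>
     (\<forall>G. G \<subseteq> F \<and> G \<noteq> {} \<and> finite G \<and> card G \<le> k \<longrightarrow> (\<exists>x. \<forall>A\<in>G. x \<in> A))"

definition maximal_k_wise_intersecting :: "nat \<Rightarrow> nat \<Rightarrow> nat set set \<Rightarrow> bool" where
  "maximal_k_wise_intersecting n k F \<longleftrightarrow>
     k_wise_intersecting n k F \<and>
     (\<forall>B. B \<subseteq> {1..n} \<and> B \<notin> F \<longrightarrow> \<not> k_wise_intersecting n k (insert B F))"

definition linked_cubes :: "nat \<Rightarrow> nat set \<Rightarrow> nat set set" where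
  "linked_cubes n S = {A. S \<subset> A \<and> A \<subseteq> {1..n}} \<union> {B. {1..n} - S \<subset> B \<and> B \<subseteq> {1..n}}"

definition balanced_linked_cubes :: "nat \<Rightarrow> nat set set \<Rightarrow> bool" where
  "balanced_linked_cubes n L \<longleftrightarrow>
     (\<exists>S. S \<subseteq> {1..n} \<and> n div 2 \<le> card S \<and> card S \<le> (n + 1) div 2 \<and> L = linked_cubes n S)"

end

theory Submission
  imports Defs "HOL-Analysis.Convex"
begin

text \<open>
  Let \<open>G\<close> be the family of complements of the members of \<open>F\<close>. By maximality every nonempty set
  outside \<open>F\<close> is a union of two disjoint members of \<open>G\<close>, so the disjointness graph on \<open>G\<close> has at
  least about \<open>2\<^sup>n\<close> edges, that is, edge density at least about \<open>1/2\<close>. Following Alon and Frankl, the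
  graph has few triangles: a positive density of triangles would give a positive density of blow-ups
  with 12 sets in each class, but one of the three disjoint unions has at most \<open>n/3\<close> elements, and
  12-tuples with so small a union are exponentially rare. Hence degrees concentrate around half
  the number of vertices, and the neighbourhood \<open>W\<close> of a typical vertex and its complement \<open>Z\<close> in \<open>G\<close>
  split the graph into two nearly independent halves with almost all cross pairs disjoint.
  Almost every set is the union of a cross pair, so every point lies in a constant proportion of \<open>W\<close>
  or of \<open>Z\<close>. Let \<open>S\<close> consist of the points popular in \<open>W\<close>. Almost all members of \<open>W\<close> are subsets
  of \<open>S\<close> and almost all members of \<open>Z\<close> are disjoint from \<open>S\<close>, and since \<open>W\<close> and \<open>Z\<close> both have about
  \<open>2 powr (n/2)\<close> members, \<open>S\<close> has exactly \<open>n/2\<close> elements.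
\<close>

section \<open>Blow-ups of ternary relations\<close>

definition tuples :: "'a set \<Rightarrow> nat \<Rightarrow> 'a list set" where
  "tuples X t = {xs. set xs \<subseteq> X \<and> length xs = t}"

lemma finite_tuples: "finite X \<Longrightarrow> finite (tuples X t)"
  unfolding tuples_def by (rule finite_lists_length_eq)

lemma card_tuples: "finite X \<Longrightarrow> card (tuples X t) = card X ^ t"
  unfolding tuples_def by (rule card_lists_length_eq)

text \<open>Jensen's inequality with uniform weights; even \<open>t\<close> makes the power convex
  on all reals, so \<open>f\<close> may take any sign.\<close>

lemma power_mean:
  fixes f :: "'a \<Rightarrow> real"
  assumes "finite Y" "Y \<noteq> {}" "even t"
  shows "((\<Sum>y\<in>Y. f y) / card Y) ^ t \<le> (\<Sum>y\<in>Y. f y ^ t) / card Y"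
  using convex_on_sum[OF assms(1,2) convex_power_even[OF assms(3)],
      where a = "\<lambda>_. 1 / card Y" and y = f] assms
  by (simp flip: sum_divide_distrib)

lemma card_pairs_eq_sum:
  assumes "finite X" "finite Y"
  shows "card {(x,y) \<in> X \<times> Y. R x y} = (\<Sum>y\<in>Y. card {x\<in>X. R x y})"
proof -
  have "card {(x,y) \<in> X \<times> Y. R x y} = card (SIGMA y:Y. {x\<in>X. R x y})"
    by (rule bij_betw_same_card[of prod.swap])
       (rule bij_betwI[where g = prod.swap], auto)
  also have "\<dots> = (\<Sum>y\<in>Y. card {x\<in>X. R x y})"
    using assms by (intro card_SigmaI) auto
  finally show ?thesis .
qed

text \<open>With \<open>f y\<close> the fraction of \<open>X\<close> related to \<open>y\<close>,
  this compares the \<open>t\<close>-th power of the mean of \<open>f\<close> with the mean of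
  \<open>f y ^ t\<close>: a tuple related to \<open>y\<close> is a free choice of \<open>t\<close>
  related entries.\<close>

lemma blowup_density:
  assumes fin: "finite X" "finite Y" and ne: "Y \<noteq> {}" and t: "even t"
  shows "(card {(x,y) \<in> X \<times> Y. R x y} / (real (card X) * card Y)) ^ t
     \<le> card {(xs,y) \<in> tuples X t \<times> Y. \<forall>x\<in>set xs. R x y} / (real (card X) ^ t * card Y)"
proof -
  define f where "f y = real (card {x\<in>X. R x y}) / card X" for y
  have tup: "{xs \<in> tuples X t. \<forall>x\<in>set xs. R x y} = tuples {x\<in>X. R x y} t" for y
    by (auto simp: tuples_def)
  have pow: "f y ^ t = card {xs \<in> tuples X t. \<forall>x\<in>set xs. R x y} / real (card X) ^ t" for y
    unfolding tup using fin by (simp add: f_def card_tuples power_divide)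
  have "card {(x,y) \<in> X \<times> Y. R x y} / (real (card X) * card Y) = (\<Sum>y\<in>Y. f y) / card Y"
    unfolding card_pairs_eq_sum[OF fin] by (simp add: f_def flip: sum_divide_distrib)
  then have "(card {(x,y) \<in> X \<times> Y. R x y} / (real (card X) * card Y)) ^ t
      \<le> (\<Sum>y\<in>Y. f y ^ t) / card Y"
    using power_mean[OF fin(2) ne t] by simp
  also have "\<dots> = card {(xs,y) \<in> tuples X t \<times> Y. \<forall>x\<in>set xs. R x y} / (real (card X) ^ t * card Y)"
    unfolding card_pairs_eq_sum[OF finite_tuples[OF fin(1)] fin(2)]
    by (simp add: pow flip: sum_divide_distrib)
  finally show ?thesis .
qed

text \<open>This is \<open>blowup_density\<close> with \<open>(y,z)\<close> as one vertex. The
  blown-up coordinate moves to the end, so three applications treat each coordinate once and restore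
  the order.\<close>

lemma blowup_density_rotate:
  assumes fin: "finite X" "finite Y" "finite Z" and ne: "Y \<noteq> {}" "Z \<noteq> {}" and t: "even t"
  shows "(card {(x,y,z) \<in> X \<times> Y \<times> Z. Q x y z} / (real (card X) * card Y * card Z)) ^ t
     \<le> card {(y,z,xs) \<in> Y \<times> Z \<times> tuples X t. \<forall>x\<in>set xs. Q x y z}
         / (real (card Y) * card Z * card (tuples X t))"
proof -
  have 1: "card {(xs,y,z) \<in> tuples X t \<times> Y \<times> Z. \<forall>x\<in>set xs. Q x y z} =
      card {(y,z,xs) \<in> Y \<times> Z \<times> tuples X t. \<forall>x\<in>set xs. Q x y z}"
    by (rule bij_betw_same_card[of "\<lambda>(x,y,z). (y,z,x)"])
       (rule bij_betwI[where g = "\<lambda>(y,z,x). (x,y,z)"], auto)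
  have 2: "{(x,y) \<in> X \<times> Y \<times> Z. case y of (y,z) \<Rightarrow> Q x y z} = {(x,y,z) \<in> X \<times> Y \<times> Z. Q x y z}"
    "{(xs,y) \<in> tuples X t \<times> Y \<times> Z. \<forall>x\<in>set xs. case y of (y,z) \<Rightarrow> Q x y z}
      = {(xs,y,z) \<in> tuples X t \<times> Y \<times> Z. \<forall>x\<in>set xs. Q x y z}"
    by auto
  show ?thesis
    using blowup_density[of X "Y \<times> Z" t "\<lambda>x (y,z). Q x y z"] assms
    unfolding 2 1
    by (simp add: card_cartesian_product card_tuples mult_ac)
qed

text \<open>\<open>d0\<close> to \<open>d3\<close> are the densities after blowing up zero to three
  coordinates; each round costs a \<open>t\<close>-th power.\<close>

lemma blowup_density_triple:
  assumes fin: "finite X" and ne: "X \<noteq> {}" and t: "even t"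
  shows "(card {(x,y,z) \<in> X \<times> X \<times> X. Q x y z} / real (card X) ^ 3) ^ (t ^ 3)
     \<le> card {(xs,ys,zs) \<in> tuples X t \<times> tuples X t \<times> tuples X t.
            \<forall>x\<in>set xs. \<forall>y\<in>set ys. \<forall>z\<in>set zs. Q x y z} / (real (card X) ^ t) ^ 3"
proof -
  let ?L = "tuples X t"
  define d0 where "d0 = card {(x,y,z) \<in> X \<times> X \<times> X. Q x y z} / (real (card X) * card X * card X)"
  define d1 where "d1 = card {(y,z,xs) \<in> X \<times> X \<times> ?L. \<forall>x\<in>set xs. Q x y z}
     / (real (card X) * card X * card ?L)"
  define d2 where "d2 = card {(z,xs,ys) \<in> X \<times> ?L \<times> ?L. \<forall>y\<in>set ys. \<forall>x\<in>set xs. Q x y z}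
     / (real (card X) * card ?L * card ?L)"
  define d3 where "d3 = card {(xs,ys,zs) \<in> ?L \<times> ?L \<times> ?L. \<forall>z\<in>set zs. \<forall>y\<in>set ys. \<forall>x\<in>set xs. Q x y z}
     / (real (card ?L) * card ?L * card ?L)"
  have L: "finite ?L" "?L \<noteq> {}"
    using fin ne card_tuples[OF fin, of t] by (auto simp: finite_tuples)
  have "d0 ^ t \<le> d1"
    unfolding d0_def d1_def by (rule blowup_density_rotate) (use assms in auto)
  moreover have "d1 ^ t \<le> d2"
    unfolding d1_def d2_def
    by (rule blowup_density_rotate[where Q = "\<lambda>y z xs. \<forall>x\<in>set xs. Q x y z"]) (use assms L in auto)
  moreover have "d2 ^ t \<le> d3"
    unfolding d2_def d3_def
    by (rule blowup_density_rotate[where Q = "\<lambda>z xs ys. \<forall>y\<in>set ys. \<forall>x\<in>set xs. Q x y z"])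
       (use assms L in auto)
  moreover have nonneg: "0 \<le> d0" "0 \<le> d1" "0 \<le> d2"
    by (auto simp: d0_def d1_def d2_def)
  ultimately have "((d0 ^ t) ^ t) ^ t \<le> d3"
    by (meson order.trans power_mono zero_le_power)
  then have "d0 ^ (t ^ 3) \<le> d3"
    by (simp add: power3_eq_cube mult.assoc flip: power_mult)
  moreover have "{(xs,ys,zs) \<in> ?L \<times> ?L \<times> ?L. \<forall>z\<in>set zs. \<forall>y\<in>set ys. \<forall>x\<in>set xs. Q x y z} =
     {(xs,ys,zs) \<in> ?L \<times> ?L \<times> ?L. \<forall>x\<in>set xs. \<forall>y\<in>set ys. \<forall>z\<in>set zs. Q x y z}"
    by blast
  ultimately show ?thesis
    using fin by (simp add: d0_def d3_def card_tuples power3_eq_cube)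
qed

section \<open>Pairwise disjoint triples\<close>

text \<open>Any even tuple length above 6 would do: for \<open>G\<close> with at least \<open>2 powr (n/2)\<close> members there are at
  least \<open>2 powr (t*n/2)\<close> tuples of length \<open>t\<close>, at most \<open>2 powr (n + t*n/3)\<close> of which have a small
  union.\<close>

lemma card_tuples_small_union:
  assumes G: "G \<subseteq> Pow {1..n}"
  shows "card {xs \<in> tuples G 12. 3 * card (\<Union>(set xs)) \<le> n} \<le> 2 ^ (5 * n)"
proof -
  let ?P = "{P \<in> Pow {1..n}. 3 * card P \<le> n}"
  have finP: "finite ?P" by auto
  \<comment> \<open>Union bound over the possible unions \<open>P\<close>: all 12 entries are
    subsets of \<open>P\<close>, and \<open>12 * card P \<le> 4 * n\<close>.\<close>
  have "{xs \<in> tuples G 12. 3 * card (\<Union>(set xs)) \<le> n} \<subseteq> (\<Union>P\<in>?P. tuples (Pow P) 12)"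
  proof clarify
    fix xs assume "xs \<in> tuples G 12" "3 * card (\<Union>(set xs)) \<le> n"
    then show "xs \<in> (\<Union>P\<in>?P. tuples (Pow P) 12)"
      using G by (intro UN_I[of "\<Union>(set xs)"]) (auto simp: tuples_def)
  qed
  moreover have fin: "finite P" if "P \<in> ?P" for P
    using that finite_subset[of P "{1..n}"] by auto
  moreover have "finite (\<Union>P\<in>?P. tuples (Pow P) 12)"
    using finP by (intro finite_UN_I) (auto intro!: finite_tuples fin)
  ultimately have "card {xs \<in> tuples G 12. 3 * card (\<Union>(set xs)) \<le> n}
      \<le> card (\<Union>P\<in>?P. tuples (Pow P) 12)"
    by (intro card_mono)
  also have "\<dots> \<le> (\<Sum>P\<in>?P. card (tuples (Pow P) 12))"
    using finP by (rule card_UN_le)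
  also have "\<dots> \<le> (\<Sum>P\<in>?P. 2 ^ (4 * n))"
  proof (rule sum_mono)
    fix P assume P: "P \<in> ?P"
    have "card (tuples (Pow P) 12) = 2 ^ (card P * 12)"
      using fin[OF P] by (simp add: card_tuples card_Pow power_mult)
    also have "\<dots> \<le> 2 ^ (4 * n)"
      using P by (intro power_increasing) auto
    finally show "card (tuples (Pow P) 12) \<le> 2 ^ (4 * n)" .
  qed
  also have "\<dots> \<le> 2 ^ n * 2 ^ (4 * n)"
    using card_mono[of "Pow {1..n}" ?P] by (auto simp: card_Pow)
  also have "\<dots> = 2 ^ (5 * n)"
    by (simp flip: power_add)
  finally show ?thesis .
qed

text \<open>The conjuncts follow the order of the triangle condition in
  \<open>few_triangles_stability\<close>.\<close>

abbreviation disjoint_triple :: "'a set \<Rightarrow> 'a set \<Rightarrow> 'a set \<Rightarrow> bool" where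
  "disjoint_triple a b c \<equiv> disjnt a b \<and> disjnt b c \<and> disjnt a c"

text \<open>In a blow-up the three unions are pairwise disjoint, so one has at most
  \<open>n / 3\<close> elements. This leaves at most \<open>3 * 2 ^ (5 * n) * card G ^ 24\<close> of
  the \<open>card G ^ 36\<close> triples of tuples.\<close>

lemma disjoint_triple_density:
  assumes G: "G \<subseteq> Pow {1..n}" and m: "2 ^ n \<le> (card G)\<^sup>2"
  shows "(card {(a,b,c) \<in> G \<times> G \<times> G. disjoint_triple a b c} / real (card G) ^ 3) ^ (12 ^ 3) \<le> 3 / 2 ^ n"
proof -
  let ?L = "tuples G 12"
  let ?S = "{xs \<in> ?L. 3 * card (\<Union>(set xs)) \<le> n}"
  let ?T = "{(as,bs,cs) \<in> ?L \<times> ?L \<times> ?L.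
            \<forall>a\<in>set as. \<forall>b\<in>set bs. \<forall>c\<in>set cs. disjoint_triple a b c}"
  have fin: "finite G" using G by (rule finite_subset) auto
  have ne: "G \<noteq> {}" using m by auto
  have finL: "finite ?L" using fin by (rule finite_tuples)
  have sub: "?T \<subseteq> ?S \<times> ?L \<times> ?L \<union> ?L \<times> ?S \<times> ?L \<union> ?L \<times> ?L \<times> ?S"
  proof
    fix x assume "x \<in> ?T"
    then obtain as bs cs where x: "x = (as, bs, cs)"
      and L: "as \<in> ?L" "bs \<in> ?L" "cs \<in> ?L"
      and Q: "\<And>a b c. a \<in> set as \<Longrightarrow> b \<in> set bs \<Longrightarrow> c \<in> set cs \<Longrightarrow> disjoint_triple a b c"
      by auto
    let ?A = "\<Union>(set as)" and ?B = "\<Union>(set bs)" and ?C = "\<Union>(set cs)"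
    \<comment> \<open>\<open>Q\<close> speaks of full triples only, so reading off one pair takes an
      entry of the third tuple.\<close>
    obtain a b c where "a \<in> set as" "b \<in> set bs" "c \<in> set cs"
      using L by (cases as; cases bs; cases cs) (auto simp: tuples_def)
    then have pw: "\<And>a b. a \<in> set as \<Longrightarrow> b \<in> set bs \<Longrightarrow> disjnt a b"
      "\<And>a c. a \<in> set as \<Longrightarrow> c \<in> set cs \<Longrightarrow> disjnt a c"
      "\<And>b c. b \<in> set bs \<Longrightarrow> c \<in> set cs \<Longrightarrow> disjnt b c"
      using Q by auto
    have sub: "?A \<subseteq> {1..n}" "?B \<subseteq> {1..n}" "?C \<subseteq> {1..n}"
      using L G by (auto simp: tuples_def)
    then have f: "finite ?A" "finite ?B" "finite ?C"
      by (meson finite_subset finite_atLeastAtMost)+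
    have "?A \<inter> ?B = {}" "?A \<inter> ?C = {}" "?B \<inter> ?C = {}"
      using pw by (auto simp: disjnt_iff)
    then have "card ?A + card ?B + card ?C = card (?A \<union> ?B \<union> ?C)"
      using f by (simp add: card_Un_disjoint Int_Un_distrib2)
    also have "\<dots> \<le> n"
      using card_mono[of "{1..n}" "?A \<union> ?B \<union> ?C"] sub by simp
    finally have "3 * card ?A \<le> n \<or> 3 * card ?B \<le> n \<or> 3 * card ?C \<le> n"
      by linarith
    then show "x \<in> ?S \<times> ?L \<times> ?L \<union> ?L \<times> ?S \<times> ?L \<union> ?L \<times> ?L \<times> ?S"
      using L x by auto
  qed
  have "card ?T \<le> card (?S \<times> ?L \<times> ?L \<union> ?L \<times> ?S \<times> ?L \<union> ?L \<times> ?L \<times> ?S)"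
    using finL by (intro card_mono sub) auto
  also have "\<dots> \<le> card (?S \<times> ?L \<times> ?L) + card (?L \<times> ?S \<times> ?L) + card (?L \<times> ?L \<times> ?S)"
    by (meson card_Un_le add_le_mono1 order.trans)
  also have "\<dots> = 3 * card ?S * (card ?L)\<^sup>2"
    by (simp add: card_cartesian_product power2_eq_square)
  also have "\<dots> \<le> 3 * 2 ^ (5 * n) * (card ?L)\<^sup>2"
    using card_tuples_small_union[OF G] by (intro mult_right_mono mult_left_mono) auto
  finally have "real (card ?T) \<le> real (3 * 2 ^ (5 * n) * (card ?L)\<^sup>2)"
    by (rule of_nat_mono)
  then have T: "real (card ?T) \<le> 3 * 2 ^ (5 * n) * (real (card G) ^ 12)\<^sup>2"
    using fin by (simp add: card_tuples)
  have pos: "real (card G) > 0" using fin ne by (simp add: card_gt_0_iff)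
  have cancel: "c * x\<^sup>2 / x ^ 3 = c / x" if "x > 0" for c x :: real
    using that by (simp add: power2_eq_square power3_eq_cube)
  \<comment> \<open>The sixth power of \<open>m\<close> puts \<open>card G ^ 12\<close> a factor
    \<open>2 ^ n\<close> above the bound on tuples with small union.\<close>
  have "(2 ^ n) ^ 6 \<le> ((card G)\<^sup>2) ^ 6"
    using m by (rule power_mono) simp
  then have "real ((2 ^ n) ^ 6) \<le> real (((card G)\<^sup>2) ^ 6)"
    by (rule of_nat_mono)
  then have m12: "(2::real) ^ n * 2 ^ (5 * n) \<le> real (card G) ^ 12"
    by (simp add: mult.commute[of n] flip: power_mult power_add)
  have "(card {(a,b,c) \<in> G \<times> G \<times> G. disjoint_triple a b c} / real (card G) ^ 3) ^ (12 ^ 3)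
     \<le> card ?T / (real (card G) ^ 12) ^ 3"
    using fin ne by (rule blowup_density_triple) simp
  also have "\<dots> \<le> 3 * 2 ^ (5 * n) * (real (card G) ^ 12)\<^sup>2 / (real (card G) ^ 12) ^ 3"
    using T by (rule divide_right_mono) simp
  also have "\<dots> = 3 * 2 ^ (5 * n) / real (card G) ^ 12"
    by (rule cancel) (use pos in simp)
  also have "\<dots> \<le> 3 * 2 ^ (5 * n) / (2 ^ n * 2 ^ (5 * n))"
    using m12 pos by (intro divide_left_mono) auto
  also have "\<dots> = 3 / 2 ^ n" by simp
  finally show ?thesis .
qed

text \<open>A fixed power of the triangle density tends to 0 uniformly in \<open>G\<close>, hence so
  does the density itself.\<close>

lemma few_disjoint_triples:
  assumes "\<delta> > 0"
  shows "\<exists>N. \<forall>n\<ge>N. \<forall>G \<subseteq> Pow {1..n}. 2 ^ n \<le> (card G)\<^sup>2 \<longrightarrow>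
     card {(a,b,c) \<in> G \<times> G \<times> G. disjoint_triple a b c} \<le> \<delta> * real (card G) ^ 3"
proof -
  define k :: nat where "k = 12 ^ 3"
  obtain N where N: "3 / \<delta> ^ k < 2 ^ N"
    using real_arch_pow[of 2 "3 / \<delta> ^ k"] by auto
  show ?thesis
  proof (intro exI[of _ N] allI impI)
    fix n G assume n: "N \<le> n" and G: "G \<subseteq> Pow {1..n}" and m: "2 ^ n \<le> (card G)\<^sup>2"
    let ?d = "card {(a,b,c) \<in> G \<times> G \<times> G. disjoint_triple a b c} / real (card G) ^ 3"
    have "3 / \<delta> ^ k < 2 ^ n"
      using N n by (meson less_le_trans one_le_numeral power_increasing)
    then have "3 / 2 ^ n < \<delta> ^ k"
      using assms by (simp add: field_simps)
    with disjoint_triple_density[OF G m, folded k_def] have "?d ^ k < \<delta> ^ k"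
      by linarith
    then have "?d < \<delta>"
      using assms by (meson less_imp_le power_less_imp_less_base)
    moreover have "card G > 0" using m by (cases "card G = 0") auto
    ultimately show "card {(a,b,c) \<in> G \<times> G \<times> G. disjoint_triple a b c} \<le> \<delta> * real (card G) ^ 3"
      by (simp add: field_simps)
  qed
qed

section \<open>Graphs with few triangles\<close>

lemma card_pairs_eq_sum_of_bool:
  assumes "finite A" "finite B"
  shows "real (card {(a,b) \<in> A \<times> B. R a b}) = (\<Sum>a\<in>A. \<Sum>b\<in>B. of_bool (R a b))"
  using assms unfolding card_pairs_eq_sum[OF assms]
  by (subst sum.swap) (simp add: Collect_conj_eq)

lemma card_triples_eq_sum_of_bool:
  assumes "finite A"
  shows "real (card {(a,b,c) \<in> A \<times> A \<times> A. Q a b c}) = (\<Sum>a\<in>A. \<Sum>b\<in>A. \<Sum>c\<in>A. of_bool (Q a b c))"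
proof -
  have "real (card {(a,p) \<in> A \<times> (A \<times> A). case p of (b,c) \<Rightarrow> Q a b c}) =
      (\<Sum>a\<in>A. \<Sum>p\<in>A \<times> A. of_bool (case p of (b,c) \<Rightarrow> Q a b c))"
    by (rule card_pairs_eq_sum_of_bool) (use assms in auto)
  also have "\<dots> = (\<Sum>a\<in>A. \<Sum>b\<in>A. \<Sum>c\<in>A. of_bool (Q a b c))"
    by (intro sum.cong refl) (simp add: sum.cartesian_product case_prod_beta)
  also have "{(a,p) \<in> A \<times> (A \<times> A). case p of (b,c) \<Rightarrow> Q a b c} = {(a,b,c) \<in> A \<times> A \<times> A. Q a b c}"
    by auto
  finally show ?thesis .
qed

text \<open>The model is the balanced complete bipartite graph, which has density 1/2 in ordered
  pairs. Few triangles push most degrees towards \<open>m / 2\<close>, and \<open>W\<close> is the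
  neighbourhood of a typical vertex.\<close>

lemma few_triangles_stability:
  fixes R :: "'a \<Rightarrow> 'a \<Rightarrow> bool" and s m :: real
  assumes fin: "finite G" and ne: "G \<noteq> {}"
    and sym: "\<And>a b. R a b = R b a"
    and m_def: "m = card G" and s: "0 < s" "s \<le> 1"
    and E: "(1/2 - s\<^sup>2) * m\<^sup>2 \<le> card {(a,b) \<in> G \<times> G. R a b}"
    and T: "card {(a,b,c) \<in> G \<times> G \<times> G. R a b \<and> R b c \<and> R a c} \<le> s\<^sup>2 * m ^ 3"
  obtains W where "W \<subseteq> G" "\<bar>card W - m / 2\<bar> \<le> 2 * s * m"
    "(1/4 - 4 * s) * m\<^sup>2 \<le> card {(a,b) \<in> W \<times> (G - W). R a b}"
    "card {(a,b) \<in> W \<times> W. R a b} + real (card {(a,b) \<in> (G - W) \<times> (G - W). R a b}) \<le> 9 * s * m\<^sup>2"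
    "card {(a,b) \<in> G \<times> G. R a b} \<le> (1/2 + s) * m\<^sup>2"
proof -
  define r :: "'a \<Rightarrow> 'a \<Rightarrow> real" where "r a b = of_bool (R a b)" for a b
  define d where "d a = (\<Sum>b\<in>G. r a b)" for a
  define t where "t a = (\<Sum>b\<in>G. \<Sum>c\<in>G. r a b * r b c * r a c)" for a
  define e where "e = real (card {(a,b) \<in> G \<times> G. R a b})"
  have r_sym: "r a b = r b a" for a b by (simp add: r_def sym)
  have mpos: "m > 0" using fin ne by (simp add: m_def card_gt_0_iff)
  have card_r: "real (card {(a,b) \<in> A \<times> B. R a b}) = (\<Sum>a\<in>A. \<Sum>b\<in>B. r a b)"
    if "A \<subseteq> G" "B \<subseteq> G" for A B
    unfolding r_def using that fin finite_subset by (intro card_pairs_eq_sum_of_bool) auto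
  have e_eq: "e = (\<Sum>a\<in>G. d a)"
    unfolding e_def d_def by (rule card_r) auto
  have T_eq: "real (card {(a,b,c) \<in> G \<times> G \<times> G. R a b \<and> R b c \<and> R a c}) = (\<Sum>a\<in>G. t a)"
    unfolding card_triples_eq_sum_of_bool[OF fin] t_def r_def
    by (intro sum.cong refl) (auto simp: of_bool_def)
  have T': "(\<Sum>a\<in>G. t a) \<le> s\<^sup>2 * m ^ 3" using T T_eq by simp
  \<comment> \<open>Adjacent \<open>a\<close> and \<open>b\<close> share at least
    \<open>d a + d b - m\<close> neighbours, and each of these closes a triangle.\<close>
  have "(\<Sum>a\<in>G. \<Sum>b\<in>G. r a b * (d a + d b - m)) \<le> (\<Sum>a\<in>G. t a)"
    unfolding t_def
  proof (intro sum_mono)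
    fix a b
    have "r a b * (d a + d b - m) = (\<Sum>c\<in>G. r a b * (r a c + r b c - 1))"
      by (simp add: d_def m_def sum.distrib sum_subtractf flip: sum_distrib_left)
    also have "\<dots> \<le> (\<Sum>c\<in>G. r a b * r b c * r a c)"
      by (intro sum_mono) (auto simp: r_def)
    finally show "r a b * (d a + d b - m) \<le> (\<Sum>c\<in>G. r a b * r b c * r a c)" .
  qed
  moreover have "(\<Sum>a\<in>G. \<Sum>b\<in>G. r a b * (d a + d b - m)) = 2 * (\<Sum>a\<in>G. (d a)\<^sup>2) - m * e"
  proof -
    have 1: "(\<Sum>a\<in>G. \<Sum>b\<in>G. r a b * d a) = (\<Sum>a\<in>G. (d a)\<^sup>2)"
      by (simp add: d_def power2_eq_square flip: sum_distrib_right)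
    have 2: "(\<Sum>a\<in>G. \<Sum>b\<in>G. r a b * d b) = (\<Sum>a\<in>G. (d a)\<^sup>2)"
      by (subst sum.swap) (subst r_sym, rule 1)
    have 3: "(\<Sum>a\<in>G. \<Sum>b\<in>G. r a b * m) = m * e"
      by (simp add: e_eq d_def mult.commute flip: sum_distrib_left)
    show ?thesis
      using 1 2 3 by (simp add: distrib_left right_diff_distrib sum.distrib sum_subtractf)
  qed
  ultimately have deg2: "2 * (\<Sum>a\<in>G. (d a)\<^sup>2) \<le> s\<^sup>2 * m ^ 3 + m * e"
    using T' by linarith
  \<comment> \<open>In the degree variance about \<open>m / 2\<close>, the main terms of
    \<open>deg2\<close> and \<open>E\<close> cancel.\<close>
  have "(d a - m/2)\<^sup>2 = (d a)\<^sup>2 - m * d a + m\<^sup>2 / 4" for a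
    by (simp add: power2_eq_square field_simps)
  then have "(\<Sum>a\<in>G. (d a - m/2)\<^sup>2) = (\<Sum>a\<in>G. (d a)\<^sup>2) - m * e + m * (m\<^sup>2 / 4)"
    by (simp add: sum.distrib sum_subtractf e_eq sum_distrib_left flip: m_def)
  then have "(\<Sum>a\<in>G. (d a - m/2)\<^sup>2) = (\<Sum>a\<in>G. (d a)\<^sup>2) - m * e + m ^ 3 / 4"
    by (simp add: power2_eq_square power3_eq_cube)
  moreover have "m * ((1/2 - s\<^sup>2) * m\<^sup>2) \<le> m * e"
    using E mpos unfolding e_def by (intro mult_left_mono) auto
  then have "m ^ 3 / 2 - s\<^sup>2 * m ^ 3 \<le> m * e"
    by (simp add: algebra_simps power3_eq_cube power2_eq_square)
  ultimately have var: "(\<Sum>a\<in>G. (d a - m/2)\<^sup>2) \<le> s\<^sup>2 * m ^ 3"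
    using deg2 by linarith
  \<comment> \<open>Cauchy-Schwarz turns the variance bound into an L1 bound, which controls degree
    sums over every subset of \<open>G\<close>.\<close>
  have "(\<Sum>a\<in>G. \<bar>d a - m/2\<bar>)\<^sup>2 \<le> (\<Sum>a\<in>G. \<bar>d a - m/2\<bar>\<^sup>2) * card G"
    by (rule sum_squared_le_sum_of_squares)
  also have "\<dots> \<le> s\<^sup>2 * m ^ 3 * m"
    using var mpos by (auto simp: m_def intro!: mult_right_mono)
  also have "\<dots> = (s * m\<^sup>2)\<^sup>2"
    by (simp add: power_mult_distrib power3_eq_cube power2_eq_square)
  finally have dev: "(\<Sum>a\<in>G. \<bar>d a - m/2\<bar>) \<le> s * m\<^sup>2"
    by (rule power2_le_imp_le) (use s in auto)
  have dev_sub: "\<bar>\<Sum>a\<in>A. d a - m/2\<bar> \<le> s * m\<^sup>2" if "A \<subseteq> G" for A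
  proof -
    have "\<bar>\<Sum>a\<in>A. d a - m/2\<bar> \<le> (\<Sum>a\<in>A. \<bar>d a - m/2\<bar>)" by (rule sum_abs)
    also have "\<dots> \<le> (\<Sum>a\<in>G. \<bar>d a - m/2\<bar>)"
      using that fin by (intro sum_mono2) auto
    finally show ?thesis using dev by linarith
  qed
  have eup: "e \<le> (1/2 + s) * m\<^sup>2"
    using dev_sub[of G] by (simp add: sum_subtractf e_eq[symmetric] flip: m_def)
      (simp add: algebra_simps power2_eq_square)
  have t_nonneg: "t a \<ge> 0" for a
    unfolding t_def r_def by (intro sum_nonneg) auto
  \<comment> \<open>Averaging: over all of \<open>G\<close> the two summands total at most
    \<open>2 * s\<^sup>2 * m ^ 3\<close>.\<close>
  have "\<exists>v\<in>G. (d v - m/2)\<^sup>2 + t v \<le> 2 * s\<^sup>2 * m\<^sup>2"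
  proof (rule ccontr)
    assume "\<not> ?thesis"
    then have "(\<Sum>v\<in>G. 2 * s\<^sup>2 * m\<^sup>2) < (\<Sum>v\<in>G. (d v - m/2)\<^sup>2 + t v)"
      using fin ne by (intro sum_strict_mono) auto
    also have "\<dots> \<le> 2 * s\<^sup>2 * m ^ 3"
      using var T' by (simp add: sum.distrib)
    finally show False
      by (simp add: power3_eq_cube power2_eq_square flip: m_def)
  qed
  then obtain v where v: "v \<in> G" "(d v - m/2)\<^sup>2 + t v \<le> 2 * s\<^sup>2 * m\<^sup>2" by auto
  define W where "W = {b\<in>G. R v b}"
  have W: "W \<subseteq> G" "finite W" using fin by (auto simp: W_def)
  have cardW: "card W = d v"
    using fin by (simp add: W_def d_def r_def Collect_conj_eq)
  have tv: "t v \<le> 2 * s\<^sup>2 * m\<^sup>2"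
    using v by (smt (verit) zero_le_power2)
  have s2: "s\<^sup>2 \<le> s" using s by (simp add: power2_eq_square mult_left_le)
  have tv': "t v \<le> 2 * s * m\<^sup>2"
    using tv s2 mult_right_mono[of "2 * s\<^sup>2" "2 * s" "m\<^sup>2"] by simp
  have "(2 * s * m)\<^sup>2 = 4 * (s\<^sup>2 * m\<^sup>2)" "0 \<le> s\<^sup>2 * m\<^sup>2"
    by (simp_all add: power_mult_distrib)
  then have "(d v - m/2)\<^sup>2 \<le> (2 * s * m)\<^sup>2"
    using v t_nonneg[of v] by linarith
  then have W_size: "\<bar>card W - m/2\<bar> \<le> 2 * s * m"
    unfolding cardW using s mpos by (simp add: power2_le_iff_abs_le)
  have restr: "(\<Sum>b\<in>W. f b) = (\<Sum>b\<in>G. r v b * f b)" for f :: "'a \<Rightarrow> real"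
    unfolding W_def r_def using fin by (intro sum.mono_neutral_cong_left) auto
  \<comment> \<open>Ordered pairs of neighbours of \<open>v\<close> that are adjacent are the
    triangles at \<open>v\<close>.\<close>
  have WW: "(\<Sum>a\<in>W. \<Sum>b\<in>W. r a b) = t v"
    unfolding restr t_def sum_distrib_left
    by (intro sum.cong refl) (simp add: mult_ac)
  let ?Z = "G - W"
  define x where "x = (\<Sum>a\<in>W. \<Sum>b\<in>?Z. r a b)"
  have split: "(\<Sum>b\<in>G. f b) = (\<Sum>b\<in>W. f b) + (\<Sum>b\<in>?Z. f b)" for f :: "'a \<Rightarrow> real"
    using sum.subset_diff[OF W(1) fin, of f] by simp
  have dW: "(\<Sum>a\<in>W. d a) = t v + x"
    unfolding d_def split x_def by (simp add: sum.distrib WW)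
  have x_sym: "(\<Sum>a\<in>?Z. \<Sum>b\<in>W. r a b) = x"
    unfolding x_def by (subst sum.swap) (simp add: r_sym)
  have e_split: "e = t v + 2 * x + (\<Sum>a\<in>?Z. \<Sum>b\<in>?Z. r a b)"
    unfolding e_eq split[of d] dW by (simp add: d_def split sum.distrib x_sym)
  \<comment> \<open>The loss \<open>4 * s\<close> in \<open>x_low\<close> collects \<open>s\<close>
    from the size of \<open>W\<close>, \<open>s\<close> from the degree deviation and
    \<open>2 * s\<close> from the pairs inside \<open>W\<close>.\<close>
  have "(1/2 - 2 * s) * m * (m/2) \<le> card W * (m/2)"
    using W_size mpos by (intro mult_right_mono) (auto simp: algebra_simps abs_le_iff)
  then have "(1/4 - s) * m\<^sup>2 \<le> card W * (m/2)"
    by (simp add: algebra_simps power2_eq_square)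
  moreover have "card W * (m/2) - s * m\<^sup>2 \<le> (\<Sum>a\<in>W. d a)"
    using dev_sub[OF W(1)] by (simp add: sum_subtractf)
  ultimately have x_low: "(1/4 - 4 * s) * m\<^sup>2 \<le> x"
    using tv' unfolding dW by (simp add: algebra_simps)
  show ?thesis
  proof
    show "W \<subseteq> G" by (rule W)
    show "\<bar>card W - m / 2\<bar> \<le> 2 * s * m" by (rule W_size)
    show "(1/4 - 4 * s) * m\<^sup>2 \<le> card {(a,b) \<in> W \<times> ?Z. R a b}"
      using x_low W card_r[of W ?Z] by (simp add: x_def)
    \<comment> \<open>Here \<open>9 * s\<close> is \<open>s\<close> from \<open>eup\<close> plus
      twice the \<open>4 * s\<close> of \<open>x_low\<close>.\<close>
    have "e - 2 * x \<le> 9 * s * m\<^sup>2"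
      using eup x_low by (simp add: algebra_simps)
    then show "card {(a,b) \<in> W \<times> W. R a b} + real (card {(a,b) \<in> ?Z \<times> ?Z. R a b}) \<le> 9 * s * m\<^sup>2"
      using W card_r[of W W] card_r[of ?Z ?Z] e_split WW by simp
    show "card {(a,b) \<in> G \<times> G. R a b} \<le> (1/2 + s) * m\<^sup>2"
      using eup by (simp add: e_def)
  qed
qed

section \<open>Families with almost all cross pairs disjoint\<close>

lemma card_pairs_lower_bound:
  fixes c :: real
  assumes "finite X" "finite Z" "X' \<subseteq> X" "\<And>x. x \<in> X' \<Longrightarrow> c \<le> card {z\<in>Z. R x z}"
  shows "card X' * c \<le> card {(x,z) \<in> X \<times> Z. R x z}"
proof -
  have "card X' * c \<le> (\<Sum>x\<in>X'. real (card {z\<in>Z. R x z}))"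
    using sum_mono[of X' "\<lambda>_. c"] assms(4) by simp
  also have "\<dots> \<le> (\<Sum>x\<in>X. real (card {z\<in>Z. R x z}))"
    using assms by (intro sum_mono2) auto
  also have "\<dots> = real (card (SIGMA x:X. {z\<in>Z. R x z}))"
    using assms by (subst card_SigmaI) auto
  also have "(SIGMA x:X. {z\<in>Z. R x z}) = {(x,z) \<in> X \<times> Z. R x z}" by auto
  finally show ?thesis .
qed

text \<open>A member of \<open>W\<close> with a point outside \<open>S\<close> meets the at least \<open>card Z / 5\<close> members of \<open>Z\<close>
  containing that point, and symmetrically for \<open>Z\<close>.\<close>

lemma cross_disjoint_imp_cubes:
  assumes fin: "finite W" "finite Z" and ne: "W \<noteq> {}"
    and sub: "\<And>A. A \<in> W \<Longrightarrow> A \<subseteq> U"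
    and cover: "\<And>i. i \<in> U \<Longrightarrow>
      2 / 5 * (real (card W) * card Z) \<le> card {(A,B) \<in> W \<times> Z. i \<in> A \<union> B}"
  obtains S where "S \<subseteq> U"
    "card {A\<in>W. \<not> A \<subseteq> S} * (real (card Z) / 5) \<le> card {(A,B) \<in> W \<times> Z. \<not> disjnt A B}"
    "card {B\<in>Z. \<not> disjnt S B} * (real (card W) / 5) \<le> card {(A,B) \<in> W \<times> Z. \<not> disjnt A B}"
proof
  define S where "S = {i\<in>U. card W / 5 \<le> card {A\<in>W. i \<in> A}}"
  show "S \<subseteq> U" by (auto simp: S_def)
  \<comment> \<open>A point outside \<open>S\<close> lies in less than a fifth of \<open>W\<close>,
    so at least one of the two fifths in \<open>cover\<close> must come from
    \<open>Z\<close>.\<close>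
  have pop: "card Z / 5 \<le> card {B\<in>Z. i \<in> B}" if i: "i \<in> U - S" for i
  proof -
    have "2 / 5 * (real (card W) * card Z) \<le> card {(A,B) \<in> W \<times> Z. i \<in> A \<union> B}"
      using cover i by auto
    also have "\<dots> \<le> card ({A\<in>W. i \<in> A} \<times> Z \<union> W \<times> {B\<in>Z. i \<in> B})"
      using fin by (intro of_nat_mono card_mono) auto
    also have "\<dots> \<le> card ({A\<in>W. i \<in> A} \<times> Z) + card (W \<times> {B\<in>Z. i \<in> B})"
      by (intro of_nat_mono card_Un_le)
    also have "\<dots> = card {A\<in>W. i \<in> A} * real (card Z) + card W * real (card {B\<in>Z. i \<in> B})"
      by (simp add: card_cartesian_product)
    also have "\<dots> \<le> card W / 5 * real (card Z) + card W * real (card {B\<in>Z. i \<in> B})"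
      using i by (intro add_right_mono mult_right_mono) (auto simp: S_def)
    finally have "card W * (card Z / 5) \<le> card W * real (card {B\<in>Z. i \<in> B})"
      by (simp add: algebra_simps)
    then show ?thesis
      using fin ne by (simp add: card_gt_0_iff)
  qed
  show "card {A\<in>W. \<not> A \<subseteq> S} * (real (card Z) / 5) \<le> card {(A,B) \<in> W \<times> Z. \<not> disjnt A B}"
  proof (rule card_pairs_lower_bound)
    fix A assume A: "A \<in> {A\<in>W. \<not> A \<subseteq> S}"
    then obtain i where i: "i \<in> A" "i \<in> U - S" using sub by auto
    have "real (card {B\<in>Z. i \<in> B}) \<le> card {B\<in>Z. \<not> disjnt A B}"
      using fin i by (intro of_nat_mono card_mono) (auto simp: disjnt_iff)
    with pop[OF i(2)] show "real (card Z) / 5 \<le> card {B\<in>Z. \<not> disjnt A B}" by linarith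
  qed (use fin in auto)
  have "card {B\<in>Z. \<not> disjnt S B} * (real (card W) / 5) \<le> card {(B,A) \<in> Z \<times> W. \<not> disjnt A B}"
  proof (rule card_pairs_lower_bound)
    fix B assume "B \<in> {B\<in>Z. \<not> disjnt S B}"
    then obtain i where i: "i \<in> B" "i \<in> S" by (auto simp: disjnt_iff)
    have "real (card {A\<in>W. i \<in> A}) \<le> card {A\<in>W. \<not> disjnt A B}"
      using fin i by (intro of_nat_mono card_mono) (auto simp: disjnt_iff)
    with i(2) show "real (card W) / 5 \<le> card {A\<in>W. \<not> disjnt A B}" by (auto simp: S_def)
  qed (use fin in auto)
  also have "card {(B,A) \<in> Z \<times> W. \<not> disjnt A B} = card {(A,B) \<in> W \<times> Z. \<not> disjnt A B}"
    by (rule bij_betw_same_card[of prod.swap]) (rule bij_betwI[where g = prod.swap], auto)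
  finally show "card {B\<in>Z. \<not> disjnt S B} * (real (card W) / 5)
      \<le> card {(A,B) \<in> W \<times> Z. \<not> disjnt A B}" .
qed

section \<open>Maximal 3-wise intersecting families\<close>

text \<open>A subfamily witnessing that \<open>X\<close> cannot be added contains \<open>X\<close>
  and at most two members of \<open>F\<close>. A single such member serves as both \<open>C\<close>
  and \<open>D\<close>; having none is impossible for nonempty \<open>X\<close>.\<close>

lemma maximal_3_wise_not_mem:
  assumes max: "maximal_k_wise_intersecting n 3 F"
    and X: "X \<subseteq> {1..n}" "X \<notin> F" "X \<noteq> {}"
  obtains C D where "C \<in> F" "D \<in> F" "X \<inter> C \<inter> D = {}"
proof -
  have F: "k_wise_intersecting n 3 F" and "\<not> k_wise_intersecting n 3 (insert X F)"
    using max X by (auto simp: maximal_k_wise_intersecting_def)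
  then obtain H where H: "H \<subseteq> insert X F" "H \<noteq> {}" "finite H" "card H \<le> 3"
    and empty: "\<not> (\<exists>x. \<forall>A\<in>H. x \<in> A)"
    using X by (auto simp: k_wise_intersecting_def)
  have "X \<in> H"
  proof (rule ccontr)
    assume "X \<notin> H"
    with H have "H \<subseteq> F" by auto
    with H empty F show False unfolding k_wise_intersecting_def by blast
  qed
  define K where "K = H - {X}"
  have H_eq: "H = insert X K" and K: "K \<subseteq> F" "finite K"
    using \<open>X \<in> H\<close> H by (auto simp: K_def)
  have "card K \<le> 2" using H \<open>X \<in> H\<close> by (simp add: K_def)
  then consider "card K = 0" | "card K = 1" | "card K = 2" by linarith
  then show thesis
  proof cases
    case 1
    with K have "K = {}" by simp
    with empty X show thesis by (auto simp: H_eq)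
  next
    case 2
    then obtain C where "K = {C}" by (auto simp: card_1_singleton_iff)
    with empty K show thesis by (intro that[of C C]) (auto simp: H_eq)
  next
    case 3
    then obtain C D where "K = {C, D}" by (auto simp: card_2_iff)
    with empty K show thesis by (intro that[of C D]) (auto simp: H_eq)
  qed
qed

lemma three_wise_intersecting_common:
  assumes "k_wise_intersecting n 3 F" "A \<in> F" "B \<in> F" "C \<in> F"
  shows "A \<inter> B \<inter> C \<noteq> {}"
proof -
  have "card {A, B, C} \<le> 3" by (simp add: card_insert_if)
  moreover have "\<forall>G. G \<subseteq> F \<and> G \<noteq> {} \<and> finite G \<and> card G \<le> 3 \<longrightarrow> (\<exists>x. \<forall>A\<in>G. x \<in> A)"
    using assms(1) unfolding k_wise_intersecting_def by (rule conjunct2)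
  ultimately have "\<exists>x. \<forall>Y\<in>{A, B, C}. x \<in> Y"
    using assms(2-4) by (elim allE[of _ "{A, B, C}"]) simp
  then show ?thesis by auto
qed

text \<open>Two members of \<open>F\<close> that block \<open>B\<close> would also have empty
  intersection with the smaller set \<open>A\<close>.\<close>

lemma maximal_3_wise_upward_closed:
  assumes max: "maximal_k_wise_intersecting n 3 F"
    and "A \<in> F" "A \<subseteq> B" "B \<subseteq> {1..n}"
  shows "B \<in> F"
proof (rule ccontr)
  assume B: "B \<notin> F"
  have F: "k_wise_intersecting n 3 F"
    using max by (simp add: maximal_k_wise_intersecting_def)
  then have "A \<noteq> {}" using three_wise_intersecting_common[OF F assms(2,2,2)] by simp
  with assms B obtain C D where "C \<in> F" "D \<in> F" "B \<inter> C \<inter> D = {}"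
    by (metis maximal_3_wise_not_mem subset_empty)
  with three_wise_intersecting_common[OF F \<open>A \<in> F\<close>, of C D] \<open>A \<subseteq> B\<close> show False
    by blast
qed

text \<open>The guard \<open>A \<subseteq> {1..n}\<close> makes complementation an involution, so
  that no set is counted with junk outside the ground set.\<close>

definition complements :: "nat \<Rightarrow> nat set set \<Rightarrow> nat set set" where
  "complements n F = {A. A \<subseteq> {1..n} \<and> {1..n} - A \<in> F}"

lemma card_complements:
  assumes "F \<subseteq> Pow {1..n}"
  shows "card (complements n F) = card F"
  by (rule bij_betw_same_card[of "\<lambda>A. {1..n} - A"])
     (rule bij_betwI[where g = "\<lambda>A. {1..n} - A"], use assms in \<open>auto simp: complements_def double_diff\<close>)

text \<open>Split \<open>X\<close> along a blocking member \<open>C\<close>: the complements of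
  \<open>X - C\<close> and \<open>X \<inter> C\<close> contain \<open>C\<close> and \<open>D\<close>
  respectively, so upward closure applies.\<close>

lemma maximal_3_wise_disjoint_union:
  assumes max: "maximal_k_wise_intersecting n 3 F"
    and X: "X \<subseteq> {1..n}" "X \<notin> F" "X \<noteq> {}"
  obtains A B where "A \<in> complements n F" "B \<in> complements n F" "disjnt A B" "X = A \<union> B"
proof -
  obtain C D where CD: "C \<in> F" "D \<in> F" "X \<inter> C \<inter> D = {}"
    using maximal_3_wise_not_mem[OF assms] .
  have "C \<subseteq> {1..n}" "D \<subseteq> {1..n}"
    using max CD by (auto simp: maximal_k_wise_intersecting_def k_wise_intersecting_def)
  then have "C \<subseteq> {1..n} - (X - C)" "D \<subseteq> {1..n} - (X \<inter> C)"
    using CD(3) by auto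
  then have "{1..n} - (X - C) \<in> F" "{1..n} - (X \<inter> C) \<in> F"
    using maximal_3_wise_upward_closed[OF max CD(1)] maximal_3_wise_upward_closed[OF max CD(2)]
    by auto
  with X show thesis
    by (intro that[of "X - C" "X \<inter> C"]) (auto simp: complements_def disjnt_iff)
qed

section \<open>Families whose disjoint unions cover almost all sets\<close>

text \<open>Each nonempty set outside \<open>F\<close> yields an ordered disjoint pair with that
  union, and also the swapped pair.\<close>

lemma disjoint_pairs_lower_bound:
  assumes "finite U" "finite G" "F \<subseteq> Pow U"
    and cover: "\<And>X. X \<subseteq> U \<Longrightarrow> X \<notin> F \<Longrightarrow> X \<noteq> {} \<Longrightarrow> \<exists>A\<in>G. \<exists>B\<in>G. disjnt A B \<and> X = A \<union> B"
  shows "2 * 2 ^ card U \<le> card {(A,B) \<in> G \<times> G. disjnt A B} + 2 * card F + 2"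
proof -
  let ?E = "{(A,B) \<in> G \<times> G. disjnt A B}"
  let ?C = "Pow U - F - {{}}"
  define f where "f X = (SOME p. p \<in> ?E \<and> fst p \<union> snd p = X)" for X
  have "f X \<in> ?E \<and> fst (f X) \<union> snd (f X) = X" if "X \<in> ?C" for X
  proof -
    from that obtain A B where "A \<in> G" "B \<in> G" "disjnt A B" "X = A \<union> B"
      using cover[of X] by auto
    then have "(A,B) \<in> ?E \<and> fst (A,B) \<union> snd (A,B) = X" by simp
    then show ?thesis unfolding f_def by (rule someI)
  qed
  then have f: "\<And>X. X \<in> ?C \<Longrightarrow> f X \<in> ?E" "\<And>X. X \<in> ?C \<Longrightarrow> fst (f X) \<union> snd (f X) = X"
    by (simp_all only:)
  let ?g = "\<lambda>X. prod.swap (f X)"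
  have swap: "fst (?g X) \<union> snd (?g X) = X" if "X \<in> ?C" for X
    using f(2)[OF that] by auto
  have inj: "inj_on f ?C" "inj_on ?g ?C"
    by (rule inj_onI, metis f(2)) (rule inj_onI, metis swap)
  \<comment> \<open>A pair counted both ways would have equal, hence empty, coordinates, but its
    union is nonempty.\<close>
  have "f ` ?C \<inter> ?g ` ?C = {}"
  proof (rule equals0I)
    fix p assume p: "p \<in> f ` ?C \<inter> ?g ` ?C"
    from IntD1[OF p] obtain X where X: "p = f X" "X \<in> ?C" by (rule imageE)
    from IntD2[OF p] obtain Y where Y: "p = ?g Y" "Y \<in> ?C" by (rule imageE)
    from X Y have XY: "X \<in> ?C" "Y \<in> ?C" "f X = ?g Y" by simp_all
    then have "X = Y" using f(2)[of X] swap[of Y] by simp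
    with XY have "fst (f X) = snd (f X)" by (metis fst_swap)
    with f[OF XY(1)] XY(1) show False by (auto simp: disjnt_def)
  qed
  moreover have "finite ?C" using assms by auto
  ultimately have "card (f ` ?C \<union> ?g ` ?C) = 2 * card ?C"
    by (subst card_Un_disjoint) (auto simp: card_image inj)
  moreover have "card (f ` ?C \<union> ?g ` ?C) \<le> card ?E"
  proof (rule card_mono)
    show "finite ?E" by (rule finite_subset[of _ "G \<times> G"]) (use assms in auto)
    have "?g X \<in> ?E" if "X \<in> ?C" for X
      using f(1)[OF that] by (auto simp: disjnt_sym)
    with f(1) show "f ` ?C \<union> ?g ` ?C \<subseteq> ?E"
      by (intro Un_least image_subsetI)
  qed
  moreover have "2 ^ card U \<le> card ?C + card F + 1"
  proof -
    have "2 ^ card U = card (Pow U)" using assms by (simp add: card_Pow)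
    also have "\<dots> \<le> card (?C \<union> F \<union> {{}})"
      using assms finite_subset[of F "Pow U"] by (intro card_mono) auto
    also have "\<dots> \<le> card ?C + card F + card {{}::'a set}"
      by (meson card_Un_le add_le_mono1 order.trans)
    finally show ?thesis by simp
  qed
  ultimately show ?thesis by linarith
qed

lemma card_subsets_containing:
  assumes "finite U" "i \<in> U"
  shows "2 * card {X. X \<subseteq> U \<and> i \<in> X} = 2 ^ card U"
proof -
  have "bij_betw (insert i) (Pow (U - {i})) {X. X \<subseteq> U \<and> i \<in> X}"
    by (rule bij_betwI[where g = "\<lambda>X. X - {i}"]) (use assms in auto)
  then have "card {X. X \<subseteq> U \<and> i \<in> X} = 2 ^ card (U - {i})"
    using assms by (simp add: bij_betw_same_card[symmetric] card_Pow)
  then show ?thesis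
    using assms by (metis card_Suc_Diff1 power_Suc)
qed

text \<open>Half of all subsets contain \<open>i\<close>. Each of them outside \<open>F\<close> is
  the union of a disjoint pair, lying across the partition or inside one part.\<close>

lemma cross_pairs_containing_lower_bound:
  assumes "finite U" "finite G" "finite F" "W \<subseteq> G" "i \<in> U"
    and cover: "\<And>X. X \<subseteq> U \<Longrightarrow> X \<notin> F \<Longrightarrow> X \<noteq> {} \<Longrightarrow> \<exists>A\<in>G. \<exists>B\<in>G. disjnt A B \<and> X = A \<union> B"
  shows "2 ^ card U \<le> 2 * (card F + card {(A,B) \<in> W \<times> (G - W). i \<in> A \<union> B}
     + card {(A,B) \<in> W \<times> W. disjnt A B} + card {(A,B) \<in> (G - W) \<times> (G - W). disjnt A B})"
proof -
  let ?u = "\<lambda>(A,B). A \<union> B"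
  let ?P = "{(A,B) \<in> W \<times> (G - W). i \<in> A \<union> B}"
    and ?Q = "{(A,B) \<in> W \<times> W. disjnt A B}" and ?R = "{(A,B) \<in> (G - W) \<times> (G - W). disjnt A B}"
  have fin: "finite ?P" "finite ?Q" "finite ?R"
    by (rule finite_subset[of _ "G \<times> G"]; use assms in auto)+
  have "{X. X \<subseteq> U \<and> i \<in> X} \<subseteq> F \<union> ?u ` ?P \<union> ?u ` ?Q \<union> ?u ` ?R"
  proof
    fix X assume X: "X \<in> {X. X \<subseteq> U \<and> i \<in> X}"
    show "X \<in> F \<union> ?u ` ?P \<union> ?u ` ?Q \<union> ?u ` ?R"
    proof (cases "X \<in> F")
      case False
      with X obtain A B where AB: "A \<in> G" "B \<in> G" "disjnt A B" "X = A \<union> B"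
        using cover[of X] by auto
      consider "A \<in> W" "B \<in> W" | "A \<notin> W" "B \<notin> W" | "A \<in> W" "B \<notin> W" | "A \<notin> W" "B \<in> W"
        by blast
      then show ?thesis
      proof cases
        case 1 then have "(A, B) \<in> ?Q" using AB by auto
        then show ?thesis using AB(4) by (auto intro!: image_eqI[of _ ?u "(A,B)"])
      next
        case 2 then have "(A, B) \<in> ?R" using AB by auto
        then show ?thesis using AB(4) by (auto intro!: image_eqI[of _ ?u "(A,B)"])
      next
        case 3 then have "(A, B) \<in> ?P" using AB X by auto
        then have "?u (A, B) \<in> ?u ` ?P" by (rule imageI)
        then show ?thesis using AB(4) by auto
      next
        case 4 then have "(B, A) \<in> ?P" using AB X by auto
        then have "?u (B, A) \<in> ?u ` ?P" by (rule imageI)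
        then show ?thesis using AB(4) by (simp add: Un_commute)
      qed
    qed simp
  qed
  then have "card {X. X \<subseteq> U \<and> i \<in> X} \<le> card (F \<union> ?u ` ?P \<union> ?u ` ?Q \<union> ?u ` ?R)"
    using fin assms by (intro card_mono) auto
  also have "\<dots> \<le> card F + card (?u ` ?P) + card (?u ` ?Q) + card (?u ` ?R)"
    by (meson card_Un_le add_le_mono1 order.trans)
  also have "\<dots> \<le> card F + card ?P + card ?Q + card ?R"
    using fin by (intro add_mono card_image_le order.refl)
  finally show ?thesis
    unfolding card_subsets_containing[OF assms(1,5), symmetric] by (rule mult_le_mono2)
qed

text \<open>The factor 2 leaves slack for approximate sizes: \<open>x\<close> need only exceed
  \<open>2 powr ((n - 1) / 2)\<close>, and integrality does the rest.\<close>

lemma half_le_of_power_bound: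
  fixes x :: real
  assumes "x \<ge> 0" "x \<le> 2 ^ k" "2 ^ n < 2 * x\<^sup>2"
  shows "n \<le> 2 * k"
proof -
  have "x\<^sup>2 \<le> (2 ^ k)\<^sup>2" using assms by (intro power_mono) auto
  with assms have "(2::real) ^ n < 2 ^ (2 * k + 1)"
    by (simp flip: power_mult add: mult.commute)
  then have "n < 2 * k + 1" by (rule power_less_imp_less_exp[rotated]) simp
  then show ?thesis by simp
qed

text \<open>By \<open>m_small\<close> the roughly \<open>2 * 2 ^ n\<close> ordered disjoint pairs
  are nearly half of all pairs, which is the density that \<open>few_triangles_stability\<close>
  asks for.\<close>

lemma disjoint_union_cover_stability:
  fixes s m :: real
  assumes G: "G \<subseteq> Pow {1..n}" and F: "F \<subseteq> Pow {1..n}" "card F = card G"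
    and cover: "\<And>X. X \<subseteq> {1..n} \<Longrightarrow> X \<notin> F \<Longrightarrow> X \<noteq> {} \<Longrightarrow>
      \<exists>A\<in>G. \<exists>B\<in>G. disjnt A B \<and> X = A \<union> B"
    and m_def: "m = card G" and s: "0 < s" "s \<le> 1/1000"
    and m_large: "8 / s\<^sup>2 \<le> m"
    and m_small: "m\<^sup>2 \<le> 4 * (1 + s\<^sup>2 / 2)\<^sup>2 * 2 ^ n"
    and T: "card {(a,b,c) \<in> G \<times> G \<times> G. disjoint_triple a b c} \<le> s\<^sup>2 * m ^ 3"
  obtains S where "S \<subseteq> {1..n}" "2 * card S = n"
    "card {A\<in>G. \<not> A \<subseteq> S \<and> \<not> A \<subseteq> {1..n} - S} \<le> 160 * s * m"
proof -
  define N :: real where "N = 2 ^ n"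
  define e where "e = real (card {(A,B) \<in> G \<times> G. disjnt A B})"
  have fin: "finite G" "finite F" using G F by (auto intro: finite_subset)
  have mpos: "m > 0" using m_large s by (smt (verit) divide_pos_pos zero_less_power)
  have ne: "G \<noteq> {}" using mpos by (auto simp: m_def)
  have s2: "0 < s\<^sup>2" "s\<^sup>2 \<le> s / 1000"
    using s by (auto simp: power2_eq_square)
  \<comment> \<open>The threshold \<open>m_large\<close> lets the quadratic error absorb the linear
    terms \<open>2 * m + 2\<close>.\<close>
  have "8 \<le> s\<^sup>2 * m" using m_large s2 by (simp add: field_simps)
  then have sm: "8 * m \<le> s\<^sup>2 * m\<^sup>2"
    using mpos mult_right_mono[of 8 "s\<^sup>2 * m" m] by (simp add: power2_eq_square mult_ac)
  have "8 \<le> m"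
    using m_large s2 s by (smt (verit) divide_le_eq_1 frac_le le_divide_eq_1 div_by_1)
  then have sm1: "m + 1 \<le> s\<^sup>2 * m\<^sup>2 / 4" using sm by linarith
  have s2m: "s\<^sup>2 * m\<^sup>2 \<le> s * m\<^sup>2 / 1000"
    using mult_right_mono[OF s2(2), of "m\<^sup>2"] by simp
  have ssm: "s * m\<^sup>2 \<le> m\<^sup>2 / 1000"
    using mult_right_mono[OF s(2), of "m\<^sup>2"] by simp
  \<comment> \<open>This inverts \<open>m_small\<close>, using that \<open>1 - s\<^sup>2\<close> is
    at most the reciprocal of \<open>(1 + s\<^sup>2 / 2)\<^sup>2\<close>.\<close>
  have N_low: "m\<^sup>2 * (1 - s\<^sup>2) / 4 \<le> N"
  proof -
    have "(1 - s\<^sup>2) * (1 + s\<^sup>2 / 2)\<^sup>2 = 1 - (s\<^sup>2)\<^sup>2 * (3/4 + s\<^sup>2 / 4)"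
      by (simp add: power2_eq_square field_simps)
    also have "\<dots> \<le> 1" by simp
    finally have 1: "(1 - s\<^sup>2) * (1 + s\<^sup>2 / 2)\<^sup>2 \<le> 1" .
    have "m\<^sup>2 * (1 - s\<^sup>2) \<le> 4 * (1 + s\<^sup>2 / 2)\<^sup>2 * N * (1 - s\<^sup>2)"
      using m_small s2 s by (intro mult_right_mono) (auto simp: N_def)
    also have "\<dots> = 4 * N * ((1 - s\<^sup>2) * (1 + s\<^sup>2 / 2)\<^sup>2)" by simp
    also have "\<dots> \<le> 4 * N * 1" using 1 by (intro mult_left_mono) (auto simp: N_def)
    finally show ?thesis by simp
  qed
  have "real (2 * 2 ^ card {1..n}) \<le> real (card {(A,B) \<in> G \<times> G. disjnt A B} + 2 * card F + 2)"
    by (intro of_nat_mono disjoint_pairs_lower_bound cover) (use fin F in auto)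
  then have e_low: "2 * N \<le> e + 2 * m + 2" using F by (simp add: e_def N_def m_def)
  \<comment> \<open>Half of the loss \<open>s\<^sup>2\<close> comes from \<open>N_low\<close>, the
    other half from \<open>sm1\<close>.\<close>
  have E: "(1/2 - s\<^sup>2) * m\<^sup>2 \<le> e"
    using e_low N_low sm1 by (simp add: algebra_simps)
  obtain W where W: "W \<subseteq> G" and W_size: "\<bar>card W - m / 2\<bar> \<le> 2 * s * m"
    and cross: "(1/4 - 4 * s) * m\<^sup>2 \<le> card {(A,B) \<in> W \<times> (G - W). disjnt A B}"
    and inner: "card {(A,B) \<in> W \<times> W. disjnt A B} +
       real (card {(A,B) \<in> (G - W) \<times> (G - W). disjnt A B}) \<le> 9 * s * m\<^sup>2"
    and e_up: "e \<le> (1/2 + s) * m\<^sup>2"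
    by (rule few_triangles_stability[OF fin(1) ne disjnt_commute m_def s(1) _ E[unfolded e_def] T])
       (use s in \<open>auto simp: e_def\<close>)
  define Z where "Z = G - W"
  have finWZ: "finite W" "finite Z" using W fin finite_subset by (auto simp: Z_def)
  have WZ: "card W + card Z = m"
    using W fin by (simp add: Z_def m_def card_Diff_subset finite_subset card_mono)
  have sm': "s * m \<le> m / 1000" using mult_right_mono[OF s(2), of m] mpos by simp
  have W_low: "m / 2 - 2 * s * m \<le> card W" and Z_low: "m / 2 - 2 * s * m \<le> card Z"
    using W_size WZ by (auto simp: abs_le_iff)
  have "card W * real (card Z) = m\<^sup>2 / 4 - (card W - m / 2)\<^sup>2"
    unfolding WZ[symmetric] by (simp add: power2_eq_square field_simps)
  then have prod: "card W * real (card Z) \<le> m\<^sup>2 / 4" by simp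
  have Wne: "W \<noteq> {}" using W_low mpos sm' by auto
  \<comment> \<open>Up to small errors \<open>N / 2\<close> is \<open>m\<^sup>2 / 8\<close>, which
    leaves room above \<open>m\<^sup>2 / 10\<close>, two fifths of the bound in
    \<open>prod\<close>.\<close>
  have cov: "2 / 5 * (real (card W) * card Z) \<le> card {(A,B) \<in> W \<times> Z. i \<in> A \<union> B}"
    if i: "i \<in> {1..n}" for i
  proof -
    let ?c = "card {(A,B) \<in> W \<times> Z. i \<in> A \<union> B}"
    have "real (2 ^ card {1..n}) \<le> real (2 * (card F + ?c + card {(A,B) \<in> W \<times> W. disjnt A B}
        + card {(A,B) \<in> Z \<times> Z. disjnt A B}))"
      unfolding Z_def
      by (intro of_nat_mono cross_pairs_containing_lower_bound cover) (use fin F W i in auto)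
    then have "N \<le> 2 * (m + ?c + 9 * s * m\<^sup>2)"
      using inner F by (simp add: N_def m_def Z_def)
    then have "m\<^sup>2 / 10 \<le> ?c"
      using N_low sm1 s2m ssm by (simp add: algebra_simps)
    then show ?thesis using prod by linarith
  qed
  let ?I = "card {(A,B) \<in> W \<times> Z. \<not> disjnt A B}"
  have "finite {(A,B) \<in> W \<times> Z. disjnt A B}" "finite {(A,B) \<in> W \<times> Z. \<not> disjnt A B}"
    by (rule finite_subset[of _ "W \<times> Z"]; use finWZ in auto)+
  then have "card ({(A,B) \<in> W \<times> Z. disjnt A B} \<union> {(A,B) \<in> W \<times> Z. \<not> disjnt A B})
      = card {(A,B) \<in> W \<times> Z. disjnt A B} + ?I"
    by (rule card_Un_disjoint) auto
  also have "{(A,B) \<in> W \<times> Z. disjnt A B} \<union> {(A,B) \<in> W \<times> Z. \<not> disjnt A B} = W \<times> Z" by auto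
  finally have "card {(A,B) \<in> W \<times> Z. disjnt A B} + ?I = card W * card Z"
    by (simp only: card_cartesian_product)
  then have "real (card {(A,B) \<in> W \<times> Z. disjnt A B} + ?I) = real (card W * card Z)"
    by (rule arg_cong)
  then have "real (card {(A,B) \<in> W \<times> Z. disjnt A B}) + ?I = card W * real (card Z)"
    by (simp only: of_nat_add of_nat_mult)
  then have I: "?I \<le> 4 * s * m\<^sup>2"
    using prod cross by (simp add: Z_def algebra_simps)
  obtain S where S: "S \<subseteq> {1..n}"
    and SW: "card {A\<in>W. \<not> A \<subseteq> S} * (real (card Z) / 5) \<le> ?I"
    and SZ: "card {B\<in>Z. \<not> disjnt S B} * (real (card W) / 5) \<le> ?I"
    by (rule cross_disjoint_imp_cubes[of W Z "{1..n}"]) (use finWZ Wne cov W G in auto)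
  \<comment> \<open>Since \<open>c\<close> is at least \<open>m / 4\<close>, dividing
    \<open>4 * s * m\<^sup>2\<close> by \<open>m / 20\<close> gives
    \<open>80 * s * m\<close>.\<close>
  have few: "b \<le> 80 * s * m" if "b * (c / 5) \<le> ?I" "m / 2 - 2 * s * m \<le> c" "0 \<le> b" for b c :: real
  proof -
    have "b * (m / 20) \<le> b * (c / 5)"
      using that sm' mpos by (intro mult_left_mono) linarith+
    also have "\<dots> \<le> 4 * s * m\<^sup>2" using that(1) I by linarith
    also have "\<dots> = (80 * s * m) * (m / 20)" by (simp add: power2_eq_square)
    finally have "b * (m / 20) \<le> (80 * s * m) * (m / 20)" .
    then show ?thesis using mpos by (simp del: times_divide_eq_right)
  qed
  have badW: "card {A\<in>W. \<not> A \<subseteq> S} \<le> 80 * s * m" using few[OF SW Z_low] by simp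
  have badZ: "card {B\<in>Z. \<not> disjnt S B} \<le> 80 * s * m" using few[OF SZ W_low] by simp
  have finS: "finite S" using S finite_subset by auto
  have sizeW: "card W \<le> card {A\<in>W. \<not> A \<subseteq> S} + real (2 ^ card S)"
  proof -
    have "card W \<le> card ({A\<in>W. \<not> A \<subseteq> S} \<union> Pow S)"
      using finWZ finS by (intro card_mono) auto
    also have "\<dots> \<le> card {A\<in>W. \<not> A \<subseteq> S} + card (Pow S)" by (rule card_Un_le)
    finally have "real (card W) \<le> real (card {A\<in>W. \<not> A \<subseteq> S} + card (Pow S))"
      by (rule of_nat_mono)
    then show ?thesis using finS by (simp add: card_Pow)
  qed
  have sizeZ: "card Z \<le> card {B\<in>Z. \<not> disjnt S B} + real (2 ^ (n - card S))"
  proof -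
    have "card Z \<le> card ({B\<in>Z. \<not> disjnt S B} \<union> Pow ({1..n} - S))"
      using finWZ G by (intro card_mono) (auto simp: Z_def disjnt_iff)
    also have "\<dots> \<le> card {B\<in>Z. \<not> disjnt S B} + card (Pow ({1..n} - S))" by (rule card_Un_le)
    finally have "real (card Z) \<le> real (card {B\<in>Z. \<not> disjnt S B} + card (Pow ({1..n} - S)))"
      by (rule of_nat_mono)
    then show ?thesis using S finS by (simp add: card_Pow card_Diff_subset)
  qed
  \<comment> \<open>Each half has at least \<open>m / 2 - 2 * s * m\<close> members, of which at
    most \<open>80 * s * m\<close> are exceptional; the rest are subsets of \<open>S\<close> or of
    its complement.\<close>
  let ?x = "m / 2 - 82 * s * m"
  have x: "?x \<ge> 0" using sm' mpos by linarith
  \<comment> \<open>By \<open>e_up\<close>, \<open>2 ^ n\<close> is at most about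
    \<open>m\<^sup>2 / 4\<close>, whereas \<open>2 * ?x\<^sup>2\<close> exceeds a third of
    \<open>m\<^sup>2\<close>.\<close>
  have "2 ^ n < 2 * ?x\<^sup>2"
  proof -
    have "?x\<^sup>2 = m\<^sup>2 / 4 - 82 * (s * m\<^sup>2) + (82 * s * m)\<^sup>2"
      by (simp add: power2_eq_square field_simps)
    then have "m\<^sup>2 / 4 - 82 * (s * m\<^sup>2) \<le> ?x\<^sup>2" by simp
    moreover have "2 * N \<le> m\<^sup>2 / 2 + s * m\<^sup>2 + 2 * m + 2"
      using e_low e_up by (simp add: algebra_simps)
    moreover have "m\<^sup>2 > 0" using mpos by simp
    ultimately show ?thesis using sm1 s2m ssm unfolding N_def by linarith
  qed
  then have half: "n \<le> 2 * card S" "n \<le> 2 * (n - card S)"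
    using half_le_of_power_bound[OF x] W_low Z_low badW badZ sizeW sizeZ by auto
  have "card {A\<in>G. \<not> A \<subseteq> S \<and> \<not> A \<subseteq> {1..n} - S}
      \<le> card ({A\<in>W. \<not> A \<subseteq> S} \<union> {B\<in>Z. \<not> disjnt S B})"
    using finWZ G by (intro card_mono) (auto simp: Z_def disjnt_iff)
  also have "\<dots> \<le> card {A\<in>W. \<not> A \<subseteq> S} + card {B\<in>Z. \<not> disjnt S B}" by (rule card_Un_le)
  finally have "real (card {A\<in>G. \<not> A \<subseteq> S \<and> \<not> A \<subseteq> {1..n} - S})
      \<le> real (card {A\<in>W. \<not> A \<subseteq> S} + card {B\<in>Z. \<not> disjnt S B})"
    by (rule of_nat_mono)
  then have "real (card {A\<in>G. \<not> A \<subseteq> S \<and> \<not> A \<subseteq> {1..n} - S})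
      \<le> card {A\<in>W. \<not> A \<subseteq> S} + real (card {B\<in>Z. \<not> disjnt S B})"
    by (simp only: of_nat_add)
  with badW badZ have "card {A\<in>G. \<not> A \<subseteq> S \<and> \<not> A \<subseteq> {1..n} - S} \<le> 160 * s * m"
    by linarith
  moreover have "card S \<le> n" using card_mono[OF _ S] by simp
  with half have "2 * card S = n" by linarith
  ultimately show thesis using S by (intro that)
qed

text \<open>Bounding the disjoint pairs by all pairs, a smaller \<open>G\<close> would have at most
  2 members, too few for \<open>n \<ge> 3\<close>. This supplies the size hypothesis of
  \<open>few_disjoint_triples\<close>.\<close>

lemma disjoint_union_cover_card:
  assumes G: "G \<subseteq> Pow {1..n}" and F: "F \<subseteq> Pow {1..n}" "card F = card G"
    and cover: "\<And>X. X \<subseteq> {1..n} \<Longrightarrow> X \<notin> F \<Longrightarrow> X \<noteq> {} \<Longrightarrow>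
      \<exists>A\<in>G. \<exists>B\<in>G. disjnt A B \<and> X = A \<union> B"
    and n: "n \<ge> 3"
  shows "2 ^ n \<le> (card G)\<^sup>2"
proof (rule ccontr)
  assume small: "\<not> ?thesis"
  define m where "m = card G"
  have fin: "finite G" using G by (auto intro: finite_subset)
  have "2 * 2 ^ card {1..n} \<le> card {(A,B) \<in> G \<times> G. disjnt A B} + 2 * card F + 2"
    by (intro disjoint_pairs_lower_bound cover) (use fin F in auto)
  moreover have "card {(A,B) \<in> G \<times> G. disjnt A B} \<le> card (G \<times> G)"
    using fin by (intro card_mono) auto
  ultimately have 1: "2 * 2 ^ n \<le> m * m + 2 * m + 2"
    using F by (simp add: m_def card_cartesian_product)
  have 2: "m * m < 2 ^ n" using small by (simp add: m_def power2_eq_square)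
  have "m \<le> 2"
  proof (rule ccontr)
    assume "\<not> m \<le> 2"
    then have "3 * m \<le> m * m" by simp
    with 1 2 \<open>\<not> m \<le> 2\<close> show False by linarith
  qed
  then have "m * m \<le> 2 * 2" by (intro mult_mono) auto
  moreover have "(2::nat) ^ 3 \<le> 2 ^ n" using n by (intro power_increasing) auto
  ultimately show False using 1 \<open>m \<le> 2\<close> by simp
qed

section \<open>The stability theorem\<close>

theorem theorem1p2:
  "\<forall>\<epsilon>::real. \<epsilon> > 0 \<longrightarrow> (\<exists>\<eta>::real. \<eta> > 0 \<and> (\<exists>N::nat. \<forall>n\<ge>N. \<forall>F.
     maximal_k_wise_intersecting n 3 F \<and>
     real (card F) \<le> (1 + \<eta>) * 2 powr ((real n + 2) / 2) \<longrightarrow>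
     even n \<and> (\<exists>L. balanced_linked_cubes n L \<and> real (card (F - L)) \<le> \<epsilon> * real (card F))))"
proof (intro allI impI)
  fix \<epsilon> :: real assume \<epsilon>: "\<epsilon> > 0"
  \<comment> \<open>The value 1/1000 serves the stability lemma; 200 exceeds its 160 to make room
    for two extra sets.\<close>
  define s where "s = min (1/1000) (\<epsilon> / 200)"
  have s: "0 < s" "s \<le> 1/1000" "200 * s \<le> \<epsilon>"
    using \<epsilon> by (auto simp: s_def min_def)
  have "s\<^sup>2 > 0" using s by simp
  from few_disjoint_triples[OF this] obtain N1 where
    N1: "\<forall>n\<ge>N1. \<forall>G \<subseteq> Pow {1..n}. 2 ^ n \<le> (card G)\<^sup>2 \<longrightarrow>
     card {(a,b,c) \<in> G \<times> G \<times> G. disjoint_triple a b c} \<le> s\<^sup>2 * real (card G) ^ 3"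
    by (rule exE)
  obtain N2 where N2: "(8 / s\<^sup>2)\<^sup>2 < 2 ^ N2"
    using real_arch_pow[of 2 "(8 / s\<^sup>2)\<^sup>2"] by auto
  show "\<exists>\<eta>::real. \<eta> > 0 \<and> (\<exists>N::nat. \<forall>n\<ge>N. \<forall>F.
     maximal_k_wise_intersecting n 3 F \<and>
     real (card F) \<le> (1 + \<eta>) * 2 powr ((real n + 2) / 2) \<longrightarrow>
     even n \<and> (\<exists>L. balanced_linked_cubes n L \<and> real (card (F - L)) \<le> \<epsilon> * real (card F)))"
  \<comment> \<open>The bound 3 is for \<open>disjoint_union_cover_card\<close>, \<open>N1\<close>
    for the triangle count, and \<open>N2\<close> for \<open>m_large\<close>.\<close>
  proof (intro exI[of _ "s\<^sup>2 / 2"] conjI exI[of _ "max 3 (max N1 N2)"] allI impI; (elim conjE)?)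
    show "s\<^sup>2 / 2 > 0" using s by simp
  next
    fix n F
    assume n: "max 3 (max N1 N2) \<le> n" and max: "maximal_k_wise_intersecting n 3 F"
      and small: "real (card F) \<le> (1 + s\<^sup>2 / 2) * 2 powr ((real n + 2) / 2)"
    define G where "G = complements n F"
    define m where "m = real (card G)"
    have F: "F \<subseteq> Pow {1..n}"
      using max by (auto simp: maximal_k_wise_intersecting_def k_wise_intersecting_def)
    have G: "G \<subseteq> Pow {1..n}" by (auto simp: G_def complements_def)
    have card_eq: "card F = card G" using card_complements[OF F] by (simp add: G_def)
    have cover: "\<exists>A\<in>G. \<exists>B\<in>G. disjnt A B \<and> X = A \<union> B"
      if "X \<subseteq> {1..n}" "X \<notin> F" "X \<noteq> {}" for X
      using maximal_3_wise_disjoint_union[OF max that] unfolding G_def by metis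
    have big: "2 ^ n \<le> (card G)\<^sup>2"
      by (rule disjoint_union_cover_card[OF G F card_eq cover]) (use n in auto)
    then have "real (2 ^ n) \<le> real ((card G)\<^sup>2)" by (rule of_nat_mono)
    then have m_low: "2 ^ n \<le> m\<^sup>2" by (simp add: m_def)
    have "(8 / s\<^sup>2)\<^sup>2 \<le> 2 ^ N2" using N2 by simp
    also have "\<dots> \<le> (2::real) ^ n" using n by (intro power_increasing) auto
    also note m_low
    finally have m_large: "8 / s\<^sup>2 \<le> m"
      by (rule power2_le_imp_le) (simp add: m_def)
    have "m\<^sup>2 \<le> ((1 + s\<^sup>2 / 2) * 2 powr ((real n + 2) / 2))\<^sup>2"
      using small by (intro power_mono) (auto simp: m_def card_eq)
    also have "\<dots> = (1 + s\<^sup>2 / 2)\<^sup>2 * (2 powr ((real n + 2) / 2))\<^sup>2"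
      by (rule power_mult_distrib)
    also have "(2 powr ((real n + 2) / 2))\<^sup>2 = (2::real) powr real (n + 2)"
      by (simp add: power2_eq_square add.commute flip: powr_add)
    also have "\<dots> = 4 * 2 ^ n"
      by (subst powr_realpow) auto
    finally have m_small: "m\<^sup>2 \<le> 4 * (1 + s\<^sup>2 / 2)\<^sup>2 * 2 ^ n"
      by (simp only: mult_ac)
    have T: "card {(a,b,c) \<in> G \<times> G \<times> G. disjoint_triple a b c} \<le> s\<^sup>2 * m ^ 3"
      unfolding m_def using N1[rule_format, OF _ G big] n by simp
    obtain S where S: "S \<subseteq> {1..n}" "2 * card S = n"
      and bad: "card {A\<in>G. \<not> A \<subseteq> S \<and> \<not> A \<subseteq> {1..n} - S} \<le> 160 * s * m"
      using disjoint_union_cover_stability[OF G F card_eq cover m_def s(1,2) m_large m_small T] .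
    let ?L = "linked_cubes n S"
    let ?Bad = "{A\<in>G. \<not> A \<subseteq> S \<and> \<not> A \<subseteq> {1..n} - S}"
    \<comment> \<open>The cubes are strict, so \<open>S\<close> and its complement may belong to
      \<open>F\<close> without lying in \<open>?L\<close>.\<close>
    have "F - ?L \<subseteq> (\<lambda>A. {1..n} - A) ` ?Bad \<union> {S, {1..n} - S}"
    proof
      fix A assume A: "A \<in> F - ?L"
      then have A_sub: "A \<subseteq> {1..n}" using F by auto
      show "A \<in> (\<lambda>A. {1..n} - A) ` ?Bad \<union> {S, {1..n} - S}"
      proof (cases "A = S \<or> A = {1..n} - S")
        case False
        with A A_sub have "\<not> S \<subseteq> A" "\<not> {1..n} - S \<subseteq> A"
          by (auto simp: linked_cubes_def psubset_eq)
        moreover have "A = {1..n} - ({1..n} - A)" using A_sub by auto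
        ultimately show ?thesis
          using A S by (intro UnI1 image_eqI[of _ _ "{1..n} - A"])
            (auto simp: G_def complements_def double_diff)
      qed auto
    qed
    moreover have fin: "finite ?Bad" using G by (auto intro: finite_subset)
    ultimately have "card (F - ?L) \<le> card ((\<lambda>A. {1..n} - A) ` ?Bad \<union> {S, {1..n} - S})"
      by (intro card_mono) auto
    also have "\<dots> \<le> card ((\<lambda>A. {1..n} - A) ` ?Bad) + card {S, {1..n} - S}" by (rule card_Un_le)
    also have "\<dots> \<le> card ?Bad + 2"
      using fin by (intro add_mono card_image_le) (auto simp: card_insert_if)
    finally have "real (card (F - ?L)) \<le> card ?Bad + 2" by linarith
    also have "\<dots> \<le> 200 * s * m"
    proof -
      \<comment> \<open>Hence \<open>s * m \<ge> 8\<close>, and the extra 2 fits into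
        \<open>40 * s * m\<close>.\<close>
      have "8 \<le> s * (s * m)" using m_large s by (simp add: field_simps power2_eq_square)
      moreover have "s * (s * m) \<le> 1 * (s * m)"
        using s by (intro mult_right_mono) (auto simp: m_def)
      ultimately show ?thesis using bad by linarith
    qed
    also have "\<dots> \<le> \<epsilon> * m" using s by (intro mult_right_mono) (auto simp: m_def)
    finally have final: "real (card (F - ?L)) \<le> \<epsilon> * card F" by (simp add: m_def card_eq)
    show "even n" using S by auto
    show "\<exists>L. balanced_linked_cubes n L \<and> real (card (F - L)) \<le> \<epsilon> * real (card F)"
      using S final by (intro exI[of _ ?L]) (auto simp: balanced_linked_cubes_def)
  qed
qed

end
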